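(* Suppose that $\alpha_i\in(0,\,2\eta/\ell_F^2)$ for all $i\in\mathcal N$ and $\gamma\in(0,\gamma_{\max})$, where $$\gamma_{\max}:=\frac{1}{\|A\|^2}\left(\frac{1}{\alpha_{\max}}-\frac{1}{2\eta/\ell_F^2}\right),\qquad \alpha_{\max}:=\max_{i\in\mathcal N}\alpha_i .$$ Then, for every initial point $(\boldsymbol x^0,\lambda^0)\in\mathbb R^{nN}\times\mathbb R^m$, the sequence $(\mathrm{col}(\boldsymbol x^k,\lambda^k))_{k=0}^\infty$ defined by $$\boldsymbol x^{k+1}=\mathrm{proj}_{\boldsymbol\Omega}\big[\boldsymbol x^k-\boldsymbol\alpha\,(F(\boldsymbol x^k)+A^\top\lambda^k)\big],$$ $$\lambda^{k+1}=\mathrm{proj}_{\mathbb R^m_{\ge0}}\big[\lambda^k+\gamma\,(2A\boldsymbol x^{k+1}-A\boldsymbol x^k-b)\big],$$ with $\boldsymbol\alpha:=\mathrm{diag}(\alpha_1,\dots,\alpha_N)\otimes I_n$, converges to some $\mathrm{col}(\boldsymbol x^*,\lambda^* )\in\mathrm{zer}(T)$.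
   Context: Setting. Let $N,n,m\ge1$ be integers and $\mathcal N=\{1,\dots,N\}$. Each agent $i\in\mathcal N$ has a local decision set $\Omega_i\subseteq\mathbb R^n$; $\boldsymbol\Omega:=\Omega_1\times\cdots\times\Omega_N\subseteq\mathbb R^{nN}$. Write $\boldsymbol x=\mathrm{col}(x_1,\dots,x_N)$ (stacked vector), and $\boldsymbol x_{-i}$ for the stack of the $x_j$, $j\ne i$. Agent $i$ has a cost function of the aggregative form $J_i(x_i,\boldsymbol x_{-i})=f_i\big(x_i,\frac1N\sum_{j=1}^N x_j\big)$. Coupling constraints are $A\boldsymbol x\le b$ (componentwise) with $A\in\mathbb R^{m\times nN}$, $b\in\mathbb R^m$, and $\boldsymbol{\mathcal X}:=\boldsymbol\Omega\cap\{\boldsymbol y\in\mathbb R^{nN}: A\boldsymbol y-b\le 0\}$. Standing assumptions. (1) For each $i$ and each $\boldsymbol y\in\mathbb R^{n(N-1)}$, $J_i(\cdot,\boldsymbol y)$ is convex and continuously differentiable (in particular finite). (2) Each $\Omega_i$ is nonempty, compact and convex, and $\boldsymbol{\mathcal X}$ satisfies Slater's constraint qualification: there is $\hat{\boldsymbol x}\in\boldsymbol\Omega$ with $A\hat{\boldsymbol x}<b$ componentwise. (3) The pseudo-gradient $F:\mathbb R^{nN}\to\mathbb R^{nN}$, $F(\boldsymbol x):=\mathrm{col}(\nabla_{x_1}J_1(x_1,\boldsymbol x_{-1}),\dots,\nabla_{x_N}J_N(x_N,\boldsymbol x_{-N}))$, is $\eta$-strongly monotone ($(F(\boldsymbol x)-F(\boldsymbol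 y))^\top(\boldsymbol x-\boldsymbol y)\ge\eta\|\boldsymbol x-\boldsymbol y\|^2$ for all $\boldsymbol x,\boldsymbol y$) and $\ell_F$-Lipschitz continuous, for some $\eta,\ell_F>0$. Notation. $\|A\|$ is the maximum singular value of $A$ (with $1/\|A\|^2:=+\infty$ if $A=0$). $\mathrm{proj}_S$ is the Euclidean projection onto $S$. $\mathrm N_S$ is the normal cone operator: $\mathrm N_S(x)=\{v:\sup_{z\in S}v^\top(z-x)\le0\}$ if $x\in S$ and $\varnothing$ otherwise. The set-valued mapping $T$ on $\mathbb R^{nN}\times\mathbb R^m$ is $$T:\begin{bmatrix}\boldsymbol x\\ \mu\end{bmatrix}\mapsto\begin{bmatrix}\mathrm N_{\boldsymbol\Omega}(\boldsymbol x)+F(\boldsymbol x)+A^\top\mu\\ \mathrm N_{\mathbb R^m_{\ge0}}(\mu)-(A\boldsymbol x-b)\end{bmatrix},$$ and $\mathrm{zer}(T)$ is the set of points $\boldsymbol\omega$ with $0\in T(\boldsymbol\omega)$. *)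

theory Defs
  imports "HOL-Analysis.Analysis"
begin

text \<open>
  Agents, local coordinates and coupling constraints are indexed by finite types \<open>'N\<close>, \<open>'n\<close>
  and \<open>'m\<close>. A stacked vector \<open>col(x\<^sub>1, \<dots>, x\<^sub>N)\<close> has type \<open>real ^ ('N \<times> 'n)\<close>; its entry
  \<open>(i, k)\<close> is the \<open>k\<close>-th coordinate of \<open>x\<^sub>i\<close>.
\<close>

definition col :: "('N::finite \<Rightarrow> real ^ 'n::finite) \<Rightarrow> real ^ ('N \<times> 'n)" where
  "col y = (\<chi> p. y (fst p) $ snd p)"

definition blk :: "real ^ ('N::finite \<times> 'n::finite) \<Rightarrow> 'N \<Rightarrow> real ^ 'n" where
  "blk x i = (\<chi> k. x $ (i, k))"

definition prod_set :: "('N::finite \<Rightarrow> (real ^ 'n::finite) set) \<Rightarrow> (real ^ ('N \<times> 'n)) set" where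
  "prod_set \<Omega> = {x. \<forall>i. blk x i \<in> \<Omega> i}"

definition gradient :: "('a::real_inner \<Rightarrow> real) \<Rightarrow> 'a \<Rightarrow> 'a" where
  "gradient \<phi> u = (THE D. GDERIV \<phi> u :> D)"

definition continuously_differentiable :: "('a::real_inner \<Rightarrow> real) \<Rightarrow> bool" where
  "continuously_differentiable \<phi> \<longleftrightarrow>
     (\<forall>u. \<exists>D. GDERIV \<phi> u :> D) \<and> continuous_on UNIV (gradient \<phi>)"

text \<open>
  \<open>agg_cost f i u x\<close> is \<open>J\<^sub>i(u, x\<^sub>-\<^sub>i)\<close>: the block \<open>x\<^sub>i\<close> of the third argument is ignored, so
  quantifying over all \<open>x\<close> amounts to quantifying over all \<open>x\<^sub>-\<^sub>i\<close>.
\<close>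

definition agg_cost ::
  "('N::finite \<Rightarrow> real ^ 'n::finite \<Rightarrow> real ^ 'n \<Rightarrow> real) \<Rightarrow> 'N \<Rightarrow> real ^ 'n \<Rightarrow> real ^ ('N \<times> 'n) \<Rightarrow> real"
  where
  "agg_cost f i u x = f i u ((1 / real CARD('N)) *\<^sub>R (u + (\<Sum>j\<in>UNIV - {i}. blk x j)))"

definition pseudo_gradient ::
  "('N::finite \<Rightarrow> real ^ 'n::finite \<Rightarrow> real ^ 'n \<Rightarrow> real) \<Rightarrow> real ^ ('N \<times> 'n) \<Rightarrow> real ^ ('N \<times> 'n)" where
  "pseudo_gradient f x = col (\<lambda>i. gradient (\<lambda>u. agg_cost f i u x) (blk x i))"

definition strongly_monotone :: "real \<Rightarrow> ('a::real_inner \<Rightarrow> 'a) \<Rightarrow> bool" where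
  "strongly_monotone \<eta> F \<longleftrightarrow> (\<forall>x y. (F x - F y) \<bullet> (x - y) \<ge> \<eta> * (norm (x - y))\<^sup>2)"

definition singular_value :: "real ^ 'c::finite ^ 'r::finite \<Rightarrow> real \<Rightarrow> bool" where
  "singular_value A \<sigma> \<longleftrightarrow>
     \<sigma> \<ge> 0 \<and> (\<exists>v. v \<noteq> 0 \<and> (transpose A ** A) *v v = \<sigma>\<^sup>2 *\<^sub>R v)"

definition max_singular_value :: "real ^ 'c::finite ^ 'r::finite \<Rightarrow> real" where
  "max_singular_value A = (GREATEST \<sigma>. singular_value A \<sigma>)"

definition nonneg_orthant :: "(real ^ 'm::finite) set" where
  "nonneg_orthant = {\<mu>. \<forall>j. 0 \<le> \<mu> $ j}"

text \<open>The supremum is taken in the extended reals since it may be infinite.\<close>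

definition normal_cone :: "'a::real_inner set \<Rightarrow> 'a \<Rightarrow> 'a set" where
  "normal_cone S x = (if x \<in> S then {v. (SUP z\<in>S. ereal (v \<bullet> (z - x))) \<le> 0} else {})"

definition kkt_op ::
  "(real ^ 'd::finite) set \<Rightarrow> (real ^ 'd \<Rightarrow> real ^ 'd) \<Rightarrow> real ^ 'd ^ 'm::finite \<Rightarrow> real ^ 'm
   \<Rightarrow> (real ^ 'd) \<times> (real ^ 'm) \<Rightarrow> ((real ^ 'd) \<times> (real ^ 'm)) set" where
  "kkt_op S F A b = (\<lambda>(x, \<mu>).
     {v + F x + transpose A *v \<mu> | v. v \<in> normal_cone S x} \<times>
     {w - (A *v x - b) | w. w \<in> normal_cone nonneg_orthant \<mu>})"

definition zer :: "('a::zero \<Rightarrow> 'a set) \<Rightarrow> 'a set" where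
  "zer T = {\<omega>. 0 \<in> T \<omega>}"

text \<open>The matrix \<open>diag(\<alpha>\<^sub>1, \<dots>, \<alpha>\<^sub>N) \<otimes> I\<^sub>n\<close>.\<close>

definition step_matrix :: "('N::finite \<Rightarrow> real) \<Rightarrow> real ^ ('N \<times> 'n::finite) ^ ('N \<times> 'n)" where
  "step_matrix \<alpha> = (\<chi> p q. if p = q then \<alpha> (fst p) else 0)"

definition gamma_max ::
  "real ^ ('N::finite \<times> 'n::finite) ^ 'm::finite \<Rightarrow> ('N \<Rightarrow> real) \<Rightarrow> real \<Rightarrow> real \<Rightarrow> ereal" where
  "gamma_max A \<alpha> \<eta> l =
     (if A = 0 then \<infinity> else ereal (1 / (max_singular_value A)\<^sup>2)) *
     ereal (1 / Max (range \<alpha>) - 1 / (2 * \<eta> / l\<^sup>2))"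

end

(*
  In the norm of the preconditioner [[alpha^-1, -A^T], [-A, 1/gamma]] the iteration is a
  forward-backward step for T: explicit in F, implicit in the normal cones and the coupling. F is
  cocoercive with constant beta = eta / l^2, and gamma < gamma_max says exactly that the
  preconditioner exceeds 1/(2 beta) on the primal block. Hence the distance to every zero of T
  decreases, the steps tend to 0, every cluster point is a zero, and by monotonicity of the distance
  to a cluster point the whole sequence converges. A zero exists: Brouwer's theorem solves the
  variational inequality over the coupled feasible set, and Slater's condition with a separating
  hyperplane gives the multiplier.
*)

theory Submission
  imports Defs
begin

section \<open>Existence of a Karush-Kuhn-Tucker point\<close>

text \<open>A fixed point of \<open>g\<close>, the projection of \<open>x - F x\<close> onto
  \<open>X\<close>, solves the inequality by the obtuse angle property of projections. Brouwer's
  theorem supplies one.\<close>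

lemma variational_inequality_solution:
  fixes F :: "'a::euclidean_space \<Rightarrow> 'a"
  assumes "compact X" "convex X" "X \<noteq> {}" "continuous_on X F"
  obtains x where "x \<in> X" "\<And>z. z \<in> X \<Longrightarrow> F x \<bullet> (z - x) \<ge> 0"
proof -
  have cl: "closed X" using assms(1) by (rule compact_imp_closed)
  define g where "g = (\<lambda>x. closest_point X (x - F x))"
  have "continuous_on X (closest_point X \<circ> (\<lambda>x. x - F x))"
    by (rule continuous_on_compose) (auto intro!: continuous_intros assms
        continuous_on_closest_point[OF assms(2) cl assms(3)])
  then have "continuous_on X g" by (simp add: g_def o_def)
  moreover have "g \<in> X \<rightarrow> X"
    using closest_point_in_set[OF cl assms(3)] by (auto simp: g_def)
  ultimately obtain x where x: "x \<in> X" "g x = x"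
    using brouwer[OF assms(1,2,3)] by (metis image_subset_iff_funcset)
  show thesis
  proof (rule that[OF x(1)])
    fix z assume "z \<in> X"
    from closest_point_dot[OF assms(2) cl this, of "x - F x"] x(2)
    show "F x \<bullet> (z - x) \<ge> 0" by (simp add: g_def)
  qed
qed

text \<open>Duality by separation: a hyperplane separates 0 from the convex set \<open>C\<close> of
  achievable (residual, objective) pairs. Its normal (\<mu>, \<tau>) has \<tau> > 0 by Slater's
  condition, and dividing by \<tau> gives the multiplier. The objective is linear because
  \<open>F\<close> will be frozen at the solution of the variational inequality.\<close>

lemma lagrange_multiplier_linear_objective:
  fixes A :: "'a::euclidean_space \<Rightarrow> real ^ 'm::finite"
  assumes lin: "linear A" and S: "convex S"
    and opt: "\<And>z. z \<in> S \<Longrightarrow> (\<And>j. A z $ j \<le> b $ j) \<Longrightarrow> c \<bullet> (z - x) \<ge> 0"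
    and slater: "z0 \<in> S" "\<And>j. A z0 $ j < b $ j"
  obtains \<mu> where "\<mu> \<in> nonneg_orthant"
    and "\<And>z. z \<in> S \<Longrightarrow> c \<bullet> (z - x) + \<mu> \<bullet> (A z - b) \<ge> 0"
proof -
  \<comment> \<open>\<open>C\<close> is upward closed in both components, which forces nonnegative
    coefficients on a separating functional. The strict inequality in the second component makes
    \<open>0 \<in> C\<close> contradict \<open>opt\<close>.\<close>
  define C where "C = {p :: (real ^ 'm) \<times> real.
     \<exists>z\<in>S. (\<forall>j. A z $ j - b $ j \<le> fst p $ j) \<and> c \<bullet> (z - x) < snd p}"
  have C_mem: "(s, t) \<in> C" if "z \<in> S" "\<And>j. A z $ j - b $ j \<le> s $ j" "c \<bullet> (z - x) < t" for s t z
    using that by (auto simp: C_def)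
  have "convex C"
  proof (rule convexI)
    fix p q :: "(real ^ 'm) \<times> real" and u v :: real
    assume pq: "p \<in> C" "q \<in> C" and uv: "0 \<le> u" "0 \<le> v" "u + v = 1"
    obtain y where y: "y \<in> S" "\<And>j. A y $ j - b $ j \<le> fst p $ j" "c \<bullet> (y - x) < snd p"
      using pq(1) by (auto simp: C_def)
    obtain z where z: "z \<in> S" "\<And>j. A z $ j - b $ j \<le> fst q $ j" "c \<bullet> (z - x) < snd q"
      using pq(2) by (auto simp: C_def)
    have "u *\<^sub>R y + v *\<^sub>R z \<in> S" using S y(1) z(1) uv by (simp add: convexD)
    moreover have "A (u *\<^sub>R y + v *\<^sub>R z) $ j - b $ j \<le> fst (u *\<^sub>R p + v *\<^sub>R q) $ j" for j
    proof -
      have "A (u *\<^sub>R y + v *\<^sub>R z) $ j - b $ j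
          = u * (A y $ j - b $ j) + v * (A z $ j - b $ j) - (1 - (u + v)) * b $ j"
        by (simp add: linear_add[OF lin] linear_cmul[OF lin] algebra_simps)
      also have "\<dots> \<le> u * fst p $ j + v * fst q $ j"
        using uv y(2)[of j] z(2)[of j] by (simp add: add_mono mult_left_mono)
      finally show ?thesis by simp
    qed
    moreover have "c \<bullet> (u *\<^sub>R y + v *\<^sub>R z - x) < snd (u *\<^sub>R p + v *\<^sub>R q)"
    proof -
      have x: "u *\<^sub>R x + v *\<^sub>R x = x" using uv(3) by (metis scaleR_left_distrib scaleR_one)
      have "u *\<^sub>R y + v *\<^sub>R z - x = u *\<^sub>R (y - x) + v *\<^sub>R (z - x)"
        using x by (simp add: algebra_simps)
      then have "c \<bullet> (u *\<^sub>R y + v *\<^sub>R z - x) = u * (c \<bullet> (y - x)) + v * (c \<bullet> (z - x))"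
        by (simp add: inner_add_right)
      also have "\<dots> < u * snd p + v * snd q"
      \<comment> \<open>If \<open>u = 0\<close>, strictness has to come from \<open>z\<close>, whose
        weight is then 1; otherwise it comes from \<open>y\<close>.\<close>
      proof (cases "u = 0")
        case True then show ?thesis using uv z(3) by simp
      next
        case False
        then have "u * (c \<bullet> (y - x)) < u * snd p" using uv y(3) by simp
        moreover have "v * (c \<bullet> (z - x)) \<le> v * snd q" using uv z(3) by (simp add: mult_left_mono)
        ultimately show ?thesis by linarith
      qed
      finally show ?thesis by simp
    qed
    ultimately show "u *\<^sub>R p + v *\<^sub>R q \<in> C" unfolding C_def by blast
  qed
  moreover have "0 \<notin> C"
    using opt by (fastforce simp: C_def)
  ultimately obtain a :: "(real ^ 'm) \<times> real" where "a \<noteq> 0" and "\<forall>p\<in>C. 0 \<le> a \<bullet> p"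
    using separating_hyperplane_set_0[of C] by blast
  then obtain \<mu> \<tau> where a0: "\<mu> \<noteq> 0 \<or> \<tau> \<noteq> 0"
    and sep: "\<And>s t. (s, t) \<in> C \<Longrightarrow> 0 \<le> \<mu> \<bullet> s + \<tau> * t"
    by (cases a) (fastforce simp: zero_prod_def)
  have \<mu>_nonneg: "0 \<le> \<mu> $ j" for j
  proof (rule ccontr)
    assume neg: "\<not> 0 \<le> \<mu> $ j"
    \<comment> \<open>Relaxing constraint \<open>j\<close> by \<open>h\<close> stays in
      \<open>C\<close>, and \<open>h\<close> is sized so that
      \<open>h * \<mu> $ j = - (\<bar>r\<bar> + 1)\<close>, which drives the functional below zero.
      The \<open>+ 1\<close> inside \<open>r\<close> meets the strict inequality in
      \<open>C\<close>.\<close>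
    define r where "r = \<mu> \<bullet> (A z0 - b) + \<tau> * (c \<bullet> (z0 - x) + 1)"
    define h where "h = (\<bar>r\<bar> + 1) / - (\<mu> $ j)"
    have h: "h \<ge> 0" using neg unfolding h_def by (intro divide_nonneg_pos) auto
    have "(A z0 - b + h *\<^sub>R axis j 1, c \<bullet> (z0 - x) + 1) \<in> C"
      by (rule C_mem[OF slater(1)]) (use h in \<open>auto simp: axis_def\<close>)
    from sep[OF this] have "0 \<le> r + h * \<mu> $ j"
      by (simp add: r_def inner_add_right inner_axis)
    moreover have "h * \<mu> $ j = - (\<bar>r\<bar> + 1)" using neg by (simp add: h_def)
    ultimately show False by linarith
  qed
  have sep': "0 \<le> \<mu> \<bullet> (A z - b) + \<tau> * (c \<bullet> (z - x) + t)" if "z \<in> S" "0 < t" for z t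
    by (rule sep, rule C_mem[OF that(1)]) (use that in auto)
  have \<tau>_pos: "0 < \<tau>"
  proof (rule ccontr)
    assume "\<not> 0 < \<tau>"
    then consider "\<tau> = 0" | "\<tau> < 0" by linarith
    then show False
    proof cases
      case 1
      \<comment> \<open>This is where Slater's point enters: all its residuals are negative, so a
        nonzero nonnegative \<mu> has a strictly negative product with them.\<close>
      have "0 \<le> \<mu> \<bullet> (A z0 - b)" using sep'[OF slater(1), of 1] 1 by simp
      moreover obtain i where i: "\<mu> $ i \<noteq> 0" using a0 1 by (auto simp: vec_eq_iff)
      have "\<mu> \<bullet> (A z0 - b) < 0"
      proof -
        have "(\<Sum>j\<in>UNIV. \<mu> $ j * (A z0 - b) $ j) < (\<Sum>j\<in>(UNIV::'m set). 0)"
        proof (rule sum_strict_mono_ex1)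
          show "\<forall>j\<in>UNIV. \<mu> $ j * (A z0 - b) $ j \<le> 0"
            using \<mu>_nonneg slater(2) by (auto intro!: mult_nonneg_nonpos simp: less_imp_le)
          show "\<exists>j\<in>UNIV. \<mu> $ j * (A z0 - b) $ j < 0"
            using i \<mu>_nonneg[of i] slater(2)[of i] by (intro bexI[of _ i]) (auto simp: mult_less_0_iff)
        qed auto
        then show ?thesis by (simp add: inner_vec_def)
      qed
      ultimately show False by simp
    next
      case 2
      \<comment> \<open>Here the objective component is raised instead: \<open>t\<close> is sized so
        that \<open>\<tau> * t\<close> outweighs \<open>r\<close>.\<close>
      define r where "r = \<mu> \<bullet> (A z0 - b) + \<tau> * (c \<bullet> (z0 - x))"
      define t where "t = (\<bar>r\<bar> + 1) / - \<tau>"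
      have "t > 0" using 2 by (simp add: t_def divide_pos_neg)
      from sep'[OF slater(1) this] have "0 \<le> r + \<tau> * t" by (simp add: r_def algebra_simps)
      moreover have "\<tau> * t = - (\<bar>r\<bar> + 1)" using 2 by (simp add: t_def)
      ultimately show False by linarith
    qed
  qed
  show thesis
  proof (rule that[of "(1 / \<tau>) *\<^sub>R \<mu>"])
    show "(1 / \<tau>) *\<^sub>R \<mu> \<in> nonneg_orthant"
      using \<mu>_nonneg \<tau>_pos by (simp add: nonneg_orthant_def)
    fix z assume z: "z \<in> S"
    have "0 \<le> \<mu> \<bullet> (A z - b) + \<tau> * (c \<bullet> (z - x))"
    \<comment> \<open>\<open>sep'\<close> holds only for positive \<open>t\<close>, because of the
      strict inequality in \<open>C\<close>; the limit as \<open>t\<close> tends to 0 is taken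
      here.\<close>
    proof (rule field_le_epsilon)
      fix e :: real assume "0 < e"
      then show "0 \<le> \<mu> \<bullet> (A z - b) + \<tau> * (c \<bullet> (z - x)) + e"
        using sep'[OF z, of "e / \<tau>"] \<tau>_pos by (simp add: algebra_simps)
    qed
    then have "0 \<le> (\<mu> \<bullet> (A z - b) + \<tau> * (c \<bullet> (z - x))) / \<tau>" using \<tau>_pos by simp
    then show "c \<bullet> (z - x) + ((1 / \<tau>) *\<^sub>R \<mu>) \<bullet> (A z - b) \<ge> 0"
      using \<tau>_pos by (simp add: add_divide_distrib add.commute)
  qed
qed

text \<open>This is membership in the zero set of \<open>T\<close> with both normal cones unfolded
  into variational inequalities. The dual set is a parameter, so that the convergence argument can
  treat it as an arbitrary closed set.\<close>

definition kkt_point ::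
  "'a::euclidean_space set \<Rightarrow> 'b::euclidean_space set \<Rightarrow> ('a \<Rightarrow> 'a) \<Rightarrow> ('a \<Rightarrow> 'b) \<Rightarrow> 'b \<Rightarrow> 'a \<Rightarrow> 'b \<Rightarrow> bool"
  where "kkt_point S \<Lambda> F A b x \<mu> \<longleftrightarrow>
    x \<in> S \<and> (\<forall>z\<in>S. 0 \<le> (F x + adjoint A \<mu>) \<bullet> (z - x)) \<and>
    \<mu> \<in> \<Lambda> \<and> (\<forall>\<nu>\<in>\<Lambda>. (A x - b) \<bullet> (\<nu> - \<mu>) \<le> 0)"

text \<open>A solution \<open>x\<close> of the variational inequality over the coupled feasible set
  minimizes the linear function \<open>F x \<bullet> z\<close> there. The multiplier of that
  minimization completes \<open>x\<close> to a KKT point.\<close>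

lemma kkt_point_exists:
  fixes A :: "'a::euclidean_space \<Rightarrow> real ^ 'm::finite"
  assumes lin: "linear A" and S: "compact S" "convex S" and F: "continuous_on S F"
    and slater: "z0 \<in> S" "\<And>j. A z0 $ j < b $ j"
  obtains x \<mu> where "kkt_point S nonneg_orthant F A b x \<mu>"
proof -
  define X where "X = S \<inter> {z. \<forall>j. A z $ j \<le> b $ j}"
  have cA: "continuous_on UNIV A" using lin by (simp add: linear_continuous_on linear_linear)
  have "{z. \<forall>j. A z $ j \<le> b $ j} = (\<Inter>j. {z. A z $ j \<le> b $ j})" by auto
  moreover have "closed {z. A z $ j \<le> b $ j}" for j
    by (intro closed_Collect_le continuous_intros cA)
  ultimately have "closed {z. \<forall>j. A z $ j \<le> b $ j}" by auto
  then have "compact X" unfolding X_def using S(1) by (rule compact_Int_closed[rotated])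
  moreover have "convex {z. \<forall>j. A z $ j \<le> b $ j}"
  proof (rule convexI)
    fix y z :: 'a and u v :: real
    assume "y \<in> {z. \<forall>j. A z $ j \<le> b $ j}" "z \<in> {z. \<forall>j. A z $ j \<le> b $ j}"
      "0 \<le> u" "0 \<le> v" "u + v = 1"
    then show "u *\<^sub>R y + v *\<^sub>R z \<in> {z. \<forall>j. A z $ j \<le> b $ j}"
      by (auto simp: linear_add[OF lin] linear_cmul[OF lin] intro!: convex_bound_le)
  qed
  then have "convex X" unfolding X_def using S(2) by (intro convex_Int)
  moreover have "X \<noteq> {}" using slater by (auto simp: X_def intro: less_imp_le)
  moreover have "continuous_on X F" using F by (rule continuous_on_subset) (auto simp: X_def)
  ultimately obtain x where x: "x \<in> X" "\<And>z. z \<in> X \<Longrightarrow> F x \<bullet> (z - x) \<ge> 0"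
    by (rule variational_inequality_solution) blast
  have xS: "x \<in> S" and feas: "\<And>j. A x $ j \<le> b $ j" using x(1) by (auto simp: X_def)
  obtain \<mu> where \<mu>: "\<mu> \<in> nonneg_orthant"
    and L: "\<And>z. z \<in> S \<Longrightarrow> F x \<bullet> (z - x) + \<mu> \<bullet> (A z - b) \<ge> 0"
    using lagrange_multiplier_linear_objective[OF lin S(2) _ slater, where c = "F x" and x = x] x(2)
    unfolding X_def by blast
  have neg: "(A x - b) \<bullet> \<nu> \<le> 0" if "\<nu> \<in> nonneg_orthant" for \<nu>
    unfolding inner_vec_def using that feas
    by (auto simp: nonneg_orthant_def intro!: sum_nonpos mult_nonpos_nonneg)
  \<comment> \<open>Complementary slackness: \<open>L\<close> at \<open>z = x\<close> gives one
    inequality, feasibility of \<open>x\<close> the other.\<close>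
  have compl: "\<mu> \<bullet> (A x - b) = 0"
    using L[OF xS] neg[OF \<mu>] by (simp add: inner_commute)
  have "kkt_point S nonneg_orthant F A b x \<mu>"
    unfolding kkt_point_def
  proof (intro conjI ballI xS \<mu>)
    fix z assume "z \<in> S"
    have "(F x + adjoint A \<mu>) \<bullet> (z - x) = F x \<bullet> (z - x) + \<mu> \<bullet> (A z - b) - \<mu> \<bullet> (A x - b)"
      using adjoint_works[OF lin, of "z - x" \<mu>]
      by (simp add: inner_add_left linear_diff[OF lin] inner_diff_right inner_diff_left inner_add_right inner_commute)
    then show "0 \<le> (F x + adjoint A \<mu>) \<bullet> (z - x)" using L[OF \<open>z \<in> S\<close>] compl by simp
  next
    fix \<nu> assume "\<nu> \<in> (nonneg_orthant :: (real ^ 'm) set)"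
    then show "(A x - b) \<bullet> (\<nu> - \<mu>) \<le> 0"
      using neg compl by (simp add: inner_diff_right inner_commute)
  qed
  then show thesis by (rule that)
qed

section \<open>The maximum singular value\<close>

text \<open>A maximizer \<open>v\<close> of \<open>norm (A *v u)\<close> on the unit sphere is an
  eigenvector of the Gram matrix. So the maximum \<sigma> is itself a singular value, and it bounds
  all the others; hence the \<open>GREATEST\<close> exists and equals the operator norm.\<close>

lemma max_singular_value:
  fixes A :: "real ^ 'c::finite ^ 'r::finite"
  shows norm_le_max_singular_value: "norm (A *v u) \<le> max_singular_value A * norm u"
    and max_singular_value_nonneg: "0 \<le> max_singular_value A"
proof -
  have gram: "((transpose A ** A) *v v) \<bullet> w = (A *v v) \<bullet> (A *v w)" for v w
    by (simp add: matrix_vector_mul_assoc[symmetric] dot_lmul_matrix)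
  have "compact (sphere (0 :: real ^ 'c) 1)" by simp
  moreover have "sphere (0 :: real ^ 'c) 1 \<noteq> {}" by simp
  moreover have "continuous_on (sphere 0 1) (\<lambda>u. norm (A *v u))"
    by (intro continuous_intros matrix_vector_mult_linear_continuous_on)
  ultimately obtain v where "v \<in> sphere 0 1"
    and max: "\<And>u. u \<in> sphere 0 1 \<Longrightarrow> norm (A *v u) \<le> norm (A *v v)"
    using continuous_attains_sup[of "sphere 0 1" "\<lambda>u. norm (A *v u)"] by blast
  then have v: "norm v = 1" by simp
  define \<sigma> where "\<sigma> = norm (A *v v)"
  have bound: "norm (A *v u) \<le> \<sigma> * norm u" for u
  proof (cases "u = 0")
    case False
    have "norm (A *v ((1 / norm u) *\<^sub>R u)) \<le> \<sigma>"
      unfolding \<sigma>_def by (rule max) (use False in simp)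
    then show ?thesis using False by (simp add: matrix_vector_mult_scaleR field_simps)
  qed simp
  \<comment> \<open>The quadratic form \<open>\<sigma>\<^sup>2 |u|\<^sup>2 - |A u|\<^sup>2\<close> is nonnegative and vanishes at \<open>v\<close>, so its polar form vanishes there as well.\<close>
  have polar: "\<sigma>\<^sup>2 * (v \<bullet> w) - (A *v v) \<bullet> (A *v w) = 0" for w
  proof (rule ccontr)
    define p where "p = \<sigma>\<^sup>2 * (v \<bullet> w) - (A *v v) \<bullet> (A *v w)"
    define q where "q = \<sigma>\<^sup>2 * (w \<bullet> w) - (A *v w) \<bullet> (A *v w)"
    assume "\<sigma>\<^sup>2 * (v \<bullet> w) - (A *v v) \<bullet> (A *v w) \<noteq> 0"
    then have p: "p \<noteq> 0" by (simp add: p_def)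
    have form: "(A *v u) \<bullet> (A *v u) \<le> \<sigma>\<^sup>2 * (u \<bullet> u)" for u
      using power_mono[OF bound[of u] norm_ge_zero, of 2]
      by (simp add: power_mult_distrib power2_norm_eq_inner)
    have vv: "v \<bullet> v = 1" using v by (simp add: norm_eq_1)
    have Avv: "(A *v v) \<bullet> (A *v v) = \<sigma>\<^sup>2" by (simp add: \<sigma>_def power2_norm_eq_inner)
    have expand: "0 \<le> 2 * t * p + t\<^sup>2 * q" for t
      using form[of "v + t *\<^sub>R w"] vv Avv
      by (simp add: p_def q_def matrix_vector_right_distrib matrix_vector_mult_scaleR
          inner_add_left inner_add_right inner_commute algebra_simps power2_eq_square)
    have q: "0 \<le> q" using form[of w] by (simp add: q_def)
    \<comment> \<open>The quadratic in \<open>t\<close> has its minimum at \<open>- p / q\<close>;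
      the shifted denominator also covers \<open>q = 0\<close> and still gives a negative
      value.\<close>
    define t where "t = - p / (q + 1)"
    have "2 * t * p + t\<^sup>2 * q = - (p\<^sup>2 * (q + 2)) / (q + 1)\<^sup>2"
      using q by (simp add: t_def divide_simps power2_eq_square) (simp add: algebra_simps)
    also have "\<dots> < 0" using p q by (intro divide_neg_pos) auto
    finally show False using expand[of t] by simp
  qed
  have "(transpose A ** A) *v v = \<sigma>\<^sup>2 *\<^sub>R v"
  proof (rule vector_eq_rdot[THEN iffD1], rule allI)
    fix w show "((transpose A ** A) *v v) \<bullet> w = (\<sigma>\<^sup>2 *\<^sub>R v) \<bullet> w"
      using polar[of w] by (simp add: gram)
  qed
  then have "singular_value A \<sigma>"
    unfolding singular_value_def using v by (auto simp: \<sigma>_def intro!: exI[of _ v])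
  moreover have "s \<le> \<sigma>" if sv: "singular_value A s" for s
  proof -
    obtain u where u: "u \<noteq> 0" "(transpose A ** A) *v u = s\<^sup>2 *\<^sub>R u" and "0 \<le> s"
      using sv by (auto simp: singular_value_def)
    have "(norm (A *v u))\<^sup>2 = (s * norm u)\<^sup>2"
      using gram[of u u] u(2) by (simp add: power2_norm_eq_inner power_mult_distrib)
    then have "norm (A *v u) = s * norm u" using \<open>0 \<le> s\<close> by (simp add: power2_eq_iff_nonneg)
    then show ?thesis using bound[of u] u(1) by simp
  qed
  ultimately have "max_singular_value A = \<sigma>"
    unfolding max_singular_value_def by (intro Greatest_equality) auto
  then show "norm (A *v u) \<le> max_singular_value A * norm u" "0 \<le> max_singular_value A"
    using bound[of u] by (auto simp: \<sigma>_def)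
qed

section \<open>The preconditioned forward-backward iteration\<close>

text \<open>The Lipschitz bound replaces the distance of the points in strong monotonicity by that
  of their images. Cocoercivity is what controls the explicit step along \<open>F\<close>.\<close>

lemma strongly_monotone_lipschitz_cocoercive:
  assumes "strongly_monotone \<eta> F" "l-lipschitz_on UNIV F" "0 < l" "0 \<le> \<eta>"
  shows "\<eta> / l\<^sup>2 * (norm (F x - F y))\<^sup>2 \<le> (F x - F y) \<bullet> (x - y)"
proof -
  have "norm (F x - F y) \<le> l * norm (x - y)"
    using lipschitz_onD[OF assms(2), of x y] by (simp add: dist_norm)
  from power_mono[OF this norm_ge_zero, of 2]
  have "(norm (F x - F y))\<^sup>2 / l\<^sup>2 \<le> (norm (x - y))\<^sup>2"
    using assms(3) by (simp add: power_mult_distrib pos_divide_le_eq mult.commute)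
  from mult_left_mono[OF this assms(4)]
  have "\<eta> / l\<^sup>2 * (norm (F x - F y))\<^sup>2 \<le> \<eta> * (norm (x - y))\<^sup>2" by simp
  also have "\<dots> \<le> (F x - F y) \<bullet> (x - y)" using assms(1) by (simp add: strongly_monotone_def)
  finally show ?thesis .
qed

text \<open>
  \<open>P\<close> is the quadratic form of the preconditioner \<open>[[D, -A\<^sup>T], [-A, 1/\<gamma>]]\<close>, where \<open>D\<close> stands for the
  inverse of the primal step size operator. The optimality conditions of the two projections say
  that one step is a resolvent step, in this metric, after a forward step along \<open>F\<close>.
\<close>

locale preconditioned_forward_backward =
  fixes S :: "'a::euclidean_space set" and \<Lambda> :: "'b::euclidean_space set"
    and F :: "'a \<Rightarrow> 'a" and A :: "'a \<Rightarrow> 'b" and b :: 'b and D :: "'a \<Rightarrow> 'a"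
    and \<gamma> \<beta> \<delta> :: real and x :: "nat \<Rightarrow> 'a" and lam :: "nat \<Rightarrow> 'b"
  assumes lin_A: "linear A" and lin_D: "linear D"
    and D_sym: "\<And>u v. D u \<bullet> v = u \<bullet> D v"
    and \<beta>_pos: "0 < \<beta>" and \<delta>_pos: "0 < \<delta>" and \<gamma>_pos: "0 < \<gamma>"
    and cocoercive: "\<And>u v. \<beta> * (norm (F u - F v))\<^sup>2 \<le> (F u - F v) \<bullet> (u - v)"
    and F_cont: "continuous_on UNIV F"
    and closed_S: "closed S" and closed_\<Lambda>: "closed \<Lambda>"
    and coercive: "\<And>u w. \<delta> * ((norm u)\<^sup>2 + (norm w)\<^sup>2) + (norm u)\<^sup>2 / (2 * \<beta>)
        \<le> D u \<bullet> u - 2 * (A u \<bullet> w) + (norm w)\<^sup>2 / \<gamma>"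
    and x_in: "\<And>k. x (Suc k) \<in> S" and lam_in: "\<And>k. lam (Suc k) \<in> \<Lambda>"
    and x_vi: "\<And>k z. z \<in> S \<Longrightarrow>
        (D (x k - x (Suc k)) - F (x k) - adjoint A (lam k)) \<bullet> (z - x (Suc k)) \<le> 0"
    and lam_vi: "\<And>k \<nu>. \<nu> \<in> \<Lambda> \<Longrightarrow>
        ((1 / \<gamma>) *\<^sub>R (lam k - lam (Suc k)) + 2 *\<^sub>R A (x (Suc k)) - A (x k) - b)
          \<bullet> (\<nu> - lam (Suc k)) \<le> 0"
begin

definition P :: "'a \<Rightarrow> 'b \<Rightarrow> real" where
  "P u w = D u \<bullet> u - 2 * (A u \<bullet> w) + (norm w)\<^sup>2 / \<gamma>"

lemma P_lower: "\<delta> * ((norm u)\<^sup>2 + (norm w)\<^sup>2) \<le> P u w"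
proof -
  have "0 \<le> (norm u)\<^sup>2 / (2 * \<beta>)" using \<beta>_pos by simp
  then show ?thesis using coercive[of u w] by (simp add: P_def)
qed

text \<open>\<open>F\<close> is evaluated at the old point \<open>v\<close> but paired with the new
  point \<open>u\<close>. Cocoercivity at \<open>v\<close> and the square of
  \<open>2 * \<beta> * g - (v - u)\<close> bound the mismatch.\<close>

lemma cross_term_lower: "- ((norm (v - u))\<^sup>2 / (2 * \<beta>)) \<le> 2 * ((F v - F y) \<bullet> (u - y))"
proof -
  define g where "g = F v - F y"
  have "0 \<le> (norm ((2 * \<beta>) *\<^sub>R g - (v - u)))\<^sup>2 / (2 * \<beta>)" using \<beta>_pos by simp
  also have "\<dots> = 2 * \<beta> * (norm g)\<^sup>2 - 2 * (g \<bullet> (v - u)) + (norm (v - u))\<^sup>2 / (2 * \<beta>)"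
    using \<beta>_pos unfolding power2_norm_eq_inner
    by (simp add: inner_diff_left inner_diff_right inner_commute divide_simps) (simp add: algebra_simps inner_commute)
  finally have "- ((norm (v - u))\<^sup>2 / (2 * \<beta>)) \<le> 2 * (\<beta> * (norm g)\<^sup>2) - 2 * (g \<bullet> (v - u))"
    by simp
  also have "\<dots> \<le> 2 * (g \<bullet> (v - y)) - 2 * (g \<bullet> (v - u))"
    using cocoercive[of v y] by (simp add: g_def)
  also have "\<dots> = 2 * (g \<bullet> (u - y))" by (simp add: inner_diff_right)
  finally show ?thesis by (simp add: g_def)
qed

text \<open>The step's optimality conditions are tested at the KKT point, and the KKT inequalities
  at the new iterate. The extrapolation \<open>2 A x' - A x\<close> makes the coupling terms fit the
  off-diagonal part of \<open>P\<close>. The loss from \<open>F\<close> is at most the term with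
  \<open>2 * \<beta>\<close> in \<open>coercive\<close>, which leaves the \<delta> term as strict
  decrease.\<close>

lemma fejer:
  assumes "kkt_point S \<Lambda> F A b y \<mu>"
  shows "P (x (Suc k) - y) (lam (Suc k) - \<mu>)
      + \<delta> * ((norm (x k - x (Suc k)))\<^sup>2 + (norm (lam k - lam (Suc k)))\<^sup>2)
      \<le> P (x k - y) (lam k - \<mu>)"
proof -
  note kkt = assms[unfolded kkt_point_def]
  define e where "e = x k - y"
  define e' where "e' = x (Suc k) - y"
  define m where "m = lam k - \<mu>"
  define m' where "m' = lam (Suc k) - \<mu>"
  have adj: "adjoint A w \<bullet> u = A u \<bullet> w" for u w
    using adjoint_works[OF lin_A, of u w] by (simp add: inner_commute)
  have x_eq: "x k = y + e" "x (Suc k) = y + e'" "lam k = \<mu> + m" "lam (Suc k) = \<mu> + m'"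
    by (simp_all add: e_def e'_def m_def m'_def)
  note lins = linear_add[OF lin_A] linear_diff[OF lin_A] linear_add[OF lin_D] linear_diff[OF lin_D]
    linear_add[OF adjoint_linear[OF lin_A]] linear_diff[OF adjoint_linear[OF lin_A]]
  have "(D (e - e') - F (x k) - adjoint A (lam k)) \<bullet> - e' \<le> 0"
    using x_vi[of y k] kkt by (simp add: e_def e'_def)
  moreover have "0 \<le> (F y + adjoint A \<mu>) \<bullet> e'"
    using kkt x_in[of k] by (simp add: e'_def)
  ultimately have 1: "(F (x k) - F y) \<bullet> e' + A e' \<bullet> m \<le> D (e - e') \<bullet> e'"
    unfolding x_eq
    by (simp add: lins inner_add_left inner_diff_left adj inner_add_right)
  have "((1 / \<gamma>) *\<^sub>R (m - m') + 2 *\<^sub>R A (x (Suc k)) - A (x k) - b) \<bullet> - m' \<le> 0"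
    using lam_vi[of \<mu> k] kkt by (simp add: m_def m'_def)
  moreover have "(A y - b) \<bullet> m' \<le> 0"
    using kkt lam_in[of k] by (simp add: m'_def)
  ultimately have 2: "A e \<bullet> m' - 2 * (A e' \<bullet> m') \<le> (m - m') \<bullet> m' / \<gamma>"
    unfolding x_eq
    by (simp add: lins inner_add_left inner_diff_left inner_add_right algebra_simps diff_divide_distrib)
  have nrm: "(norm m)\<^sup>2 - (norm m')\<^sup>2 - (norm (m - m'))\<^sup>2 = 2 * ((m - m') \<bullet> m')"
    by (simp add: power2_norm_eq_inner inner_diff_left inner_diff_right inner_commute)
  \<comment> \<open>Three-point identity: the right-hand side is twice the \<open>P\<close>-inner
    product of the step with the new error.\<close>
  have "P e m - P e' m' - P (e - e') (m - m')
      = 2 * (D (e - e') \<bullet> e') + 2 * (2 * (A e' \<bullet> m') - A e \<bullet> m' - A e' \<bullet> m)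
        + ((norm m)\<^sup>2 - (norm m')\<^sup>2 - (norm (m - m'))\<^sup>2) / \<gamma>"
    using D_sym[of e e'] unfolding P_def
    by (simp add: lins inner_diff_left inner_diff_right inner_commute algebra_simps
        add_divide_distrib diff_divide_distrib)
  also have "\<dots> \<ge> 2 * ((F (x k) - F y) \<bullet> e')"
    unfolding nrm using 1 2 by simp
  finally have "2 * ((F (x k) - F y) \<bullet> e') \<le> P e m - P e' m' - P (e - e') (m - m')" .
  moreover have "- ((norm (e - e'))\<^sup>2 / (2 * \<beta>)) \<le> 2 * ((F (x k) - F y) \<bullet> e')"
    using cross_term_lower[of "x k" "x (Suc k)" y] by (simp add: e_def e'_def)
  moreover have "\<delta> * ((norm (e - e'))\<^sup>2 + (norm (m - m'))\<^sup>2) + (norm (e - e'))\<^sup>2 / (2 * \<beta>)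
      \<le> P (e - e') (m - m')"
    using coercive[of "e - e'" "m - m'"] by (simp add: P_def)
  ultimately have "P e' m' + \<delta> * ((norm (e - e'))\<^sup>2 + (norm (m - m'))\<^sup>2) \<le> P e m" by linarith
  then show ?thesis by (simp add: e_def e'_def m_def m'_def)
qed

lemma sum_squares_le_null_sequence:
  assumes le: "\<And>k. \<delta> * ((norm (u k))\<^sup>2 + (norm (w k))\<^sup>2) \<le> r k" and r: "r \<longlonglongrightarrow> 0"
  shows "u \<longlonglongrightarrow> 0" "w \<longlonglongrightarrow> 0"
proof -
  have lim: "(\<lambda>k. r k / \<delta>) \<longlonglongrightarrow> 0"
    using tendsto_divide[OF r tendsto_const, of \<delta>] \<delta>_pos by simp
  have sum_le: "(norm (u k))\<^sup>2 + (norm (w k))\<^sup>2 \<le> r k / \<delta>" for k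
    using le[of k] \<delta>_pos by (simp add: field_simps)
  have bd: "(norm (u k))\<^sup>2 \<le> r k / \<delta>" "(norm (w k))\<^sup>2 \<le> r k / \<delta>" for k
    using sum_le[of k] zero_le_power2[of "norm (u k)"] zero_le_power2[of "norm (w k)"] by linarith+
  have "(\<lambda>k. (norm (u k))\<^sup>2) \<longlonglongrightarrow> 0" "(\<lambda>k. (norm (w k))\<^sup>2) \<longlonglongrightarrow> 0"
    by (rule tendsto_sandwich[OF _ _ tendsto_const lim]; use bd in simp)+
  from this[THEN tendsto_real_sqrt] show "u \<longlonglongrightarrow> 0" "w \<longlonglongrightarrow> 0"
    by (simp_all add: tendsto_norm_zero_iff)
qed

lemma P_nonneg: "0 \<le> P u w"
proof -
  have "0 \<le> \<delta> * ((norm u)\<^sup>2 + (norm w)\<^sup>2)" using \<delta>_pos by simp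
  then show ?thesis using P_lower[of u w] by linarith
qed

lemma P_decseq:
  assumes "kkt_point S \<Lambda> F A b y \<mu>"
  shows "decseq (\<lambda>k. P (x k - y) (lam k - \<mu>))"
proof (rule decseq_SucI)
  fix k
  have "0 \<le> \<delta> * ((norm (x k - x (Suc k)))\<^sup>2 + (norm (lam k - lam (Suc k)))\<^sup>2)"
    using \<delta>_pos by simp
  then show "P (x (Suc k) - y) (lam (Suc k) - \<mu>) \<le> P (x k - y) (lam k - \<mu>)"
    using fejer[OF assms, of k] by linarith
qed

text \<open>A decreasing sequence bounded below converges, so its consecutive differences tend to 0;
  by \<open>fejer\<close> they dominate the squared steps.\<close>

lemma steps_vanish:
  assumes kkt: "kkt_point S \<Lambda> F A b y \<mu>"
  shows "(\<lambda>k. x k - x (Suc k)) \<longlonglongrightarrow> 0" "(\<lambda>k. lam k - lam (Suc k)) \<longlonglongrightarrow> 0"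
proof -
  define V where "V = (\<lambda>k. P (x k - y) (lam k - \<mu>))"
  have "decseq V" unfolding V_def by (rule P_decseq[OF kkt])
  then obtain L where L: "V \<longlonglongrightarrow> L"
    using decseq_convergent[of V 0] P_nonneg unfolding V_def by blast
  have lim: "(\<lambda>k. V k - V (Suc k)) \<longlonglongrightarrow> 0"
    using tendsto_diff[OF L LIMSEQ_Suc[OF L]] by simp
  have le: "\<delta> * ((norm (x k - x (Suc k)))\<^sup>2 + (norm (lam k - lam (Suc k)))\<^sup>2) \<le> V k - V (Suc k)"
    for k using fejer[OF kkt, of k] by (simp add: V_def)
  show "(\<lambda>k. x k - x (Suc k)) \<longlonglongrightarrow> 0" "(\<lambda>k. lam k - lam (Suc k)) \<longlonglongrightarrow> 0"
    using sum_squares_le_null_sequence[OF le lim] by auto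
qed

lemma iterates_bounded:
  assumes kkt: "kkt_point S \<Lambda> F A b y \<mu>"
  shows "bounded (range (\<lambda>k. (x k, lam k)))"
proof -
  define R where "R = sqrt (P (x 0 - y) (lam 0 - \<mu>) / \<delta>)"
  have "dist (y, \<mu>) (x k, lam k) \<le> R" for k
  proof -
    have "\<delta> * ((norm (x k - y))\<^sup>2 + (norm (lam k - \<mu>))\<^sup>2) \<le> P (x 0 - y) (lam 0 - \<mu>)"
      using P_lower[of "x k - y" "lam k - \<mu>"] decseqD[OF P_decseq[OF kkt], of 0 k] by simp
    then have "(norm (x k - y))\<^sup>2 + (norm (lam k - \<mu>))\<^sup>2 \<le> P (x 0 - y) (lam 0 - \<mu>) / \<delta>"
      using \<delta>_pos by (simp add: field_simps)
    then show ?thesis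
      unfolding R_def dist_Pair_Pair fst_conv snd_conv
      by (intro real_sqrt_le_mono) (simp add: dist_norm norm_minus_commute)
  qed
  then show ?thesis unfolding bounded_def by blast
qed

text \<open>As the steps vanish, \<open>x (r k)\<close> and \<open>x (Suc (r k))\<close> have the
  same limit, and likewise for \<open>lam\<close>. In the limit of the two projection inequalities
  the step terms drop out and the extrapolation collapses to \<open>A y\<close>.\<close>

lemma cluster_point_is_kkt:
  assumes r: "strict_mono r" and lim: "(x \<circ> r) \<longlonglongrightarrow> y" "(lam \<circ> r) \<longlonglongrightarrow> \<mu>"
    and steps: "(\<lambda>k. x k - x (Suc k)) \<longlonglongrightarrow> 0" "(\<lambda>k. lam k - lam (Suc k)) \<longlonglongrightarrow> 0"
  shows "kkt_point S \<Lambda> F A b y \<mu>"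
proof -
  have steps': "(\<lambda>k. x (r k) - x (Suc (r k))) \<longlonglongrightarrow> 0" "(\<lambda>k. lam (r k) - lam (Suc (r k))) \<longlonglongrightarrow> 0"
    using steps[THEN LIMSEQ_subseq_LIMSEQ, OF r] by (simp_all add: o_def)
  have cur: "(\<lambda>k. x (r k)) \<longlonglongrightarrow> y" "(\<lambda>k. lam (r k)) \<longlonglongrightarrow> \<mu>"
    using lim by (simp_all add: o_def)
  have nxt: "(\<lambda>k. x (Suc (r k))) \<longlonglongrightarrow> y" "(\<lambda>k. lam (Suc (r k))) \<longlonglongrightarrow> \<mu>"
    using tendsto_diff[OF cur(1) steps'(1)] tendsto_diff[OF cur(2) steps'(2)] by simp_all
  have bl: "bounded_linear A" "bounded_linear D" "bounded_linear (adjoint A)"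
    using lin_A lin_D adjoint_linear[OF lin_A] by (simp_all add: linear_conv_bounded_linear)
  have F_lim: "(\<lambda>k. F (x (r k))) \<longlonglongrightarrow> F y"
    using continuous_on_tendsto_compose[OF F_cont cur(1)] by simp
  \<comment> \<open>Membership is taken from the successors, since the initial point need not lie in
    the sets.\<close>
  have "y \<in> S" "\<mu> \<in> \<Lambda>"
    using closed_sequentially[OF closed_S _ nxt(1)] closed_sequentially[OF closed_\<Lambda> _ nxt(2)]
      x_in lam_in by auto
  moreover have "0 \<le> (F y + adjoint A \<mu>) \<bullet> (z - y)" if "z \<in> S" for z
  proof -
    have "(\<lambda>k. (D (x (r k) - x (Suc (r k))) - F (x (r k)) - adjoint A (lam (r k)))
        \<bullet> (z - x (Suc (r k)))) \<longlonglongrightarrow> (D 0 - F y - adjoint A \<mu>) \<bullet> (z - y)"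
      by (intro tendsto_intros bl[THEN bounded_linear.tendsto] steps' cur nxt F_lim)
    from LIMSEQ_le_const2[OF this, of 0] have "(D 0 - F y - adjoint A \<mu>) \<bullet> (z - y) \<le> 0"
      using x_vi[OF that] by blast
    then show ?thesis
      by (simp add: linear_0[OF lin_D] inner_diff_left inner_add_left)
  qed
  moreover have "(A y - b) \<bullet> (\<nu> - \<mu>) \<le> 0" if "\<nu> \<in> \<Lambda>" for \<nu>
  proof -
    have "(\<lambda>k. ((1 / \<gamma>) *\<^sub>R (lam (r k) - lam (Suc (r k))) + 2 *\<^sub>R A (x (Suc (r k))) - A (x (r k)) - b)
        \<bullet> (\<nu> - lam (Suc (r k)))) \<longlonglongrightarrow> ((1 / \<gamma>) *\<^sub>R 0 + 2 *\<^sub>R A y - A y - b) \<bullet> (\<nu> - \<mu>)"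
      by (intro tendsto_intros bl[THEN bounded_linear.tendsto] steps' cur nxt)
    from LIMSEQ_le_const2[OF this, of 0]
    have "((1 / \<gamma>) *\<^sub>R 0 + 2 *\<^sub>R A y - A y - b) \<bullet> (\<nu> - \<mu>) \<le> 0"
      using lam_vi[OF that] by blast
    then show ?thesis by (simp add: scaleR_2)
  qed
  ultimately show ?thesis by (simp add: kkt_point_def)
qed

text \<open>The given KKT point serves only to obtain a cluster point, which is again a KKT point.
  The \<open>P\<close>-distance to that cluster point decreases and tends to 0 along a subsequence,
  hence along the whole sequence.\<close>

theorem converges_to_kkt_point:
  assumes kkt: "kkt_point S \<Lambda> F A b y0 \<mu>0"
  obtains y \<mu> where "kkt_point S \<Lambda> F A b y \<mu>" "x \<longlonglongrightarrow> y" "lam \<longlonglongrightarrow> \<mu>"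
proof -
  obtain l r where r: "strict_mono r" and l: "((\<lambda>k. (x k, lam k)) \<circ> r) \<longlonglongrightarrow> l"
    using bounded_imp_convergent_subsequence[OF iterates_bounded[OF kkt]] by blast
  obtain y \<mu> where "l = (y, \<mu>)" by (cases l)
  then have lim: "(x \<circ> r) \<longlonglongrightarrow> y" "(lam \<circ> r) \<longlonglongrightarrow> \<mu>"
    using tendsto_fst[OF l] tendsto_snd[OF l] by (simp_all add: o_def)
  have kkt': "kkt_point S \<Lambda> F A b y \<mu>"
    by (rule cluster_point_is_kkt[OF r lim steps_vanish[OF kkt]])
  define V where "V = (\<lambda>k. P (x k - y) (lam k - \<mu>))"
  have "decseq V" unfolding V_def by (rule P_decseq[OF kkt'])
  then obtain L where L: "V \<longlonglongrightarrow> L"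
    using decseq_convergent[of V 0] P_nonneg unfolding V_def by blast
  have bl: "bounded_linear A" "bounded_linear D"
    using lin_A lin_D by (simp_all add: linear_conv_bounded_linear)
  have "(V \<circ> r) \<longlonglongrightarrow> P (y - y) (\<mu> - \<mu>)"
    using lim \<gamma>_pos unfolding V_def P_def o_def
    by (intro tendsto_intros bl[THEN bounded_linear.tendsto]) auto
  then have "(V \<circ> r) \<longlonglongrightarrow> 0" by (simp add: P_def)
  with LIMSEQ_subseq_LIMSEQ[OF L r] have "L = 0" by (rule LIMSEQ_unique)
  with L have V0: "V \<longlonglongrightarrow> 0" by simp
  have le: "\<delta> * ((norm (x k - y))\<^sup>2 + (norm (lam k - \<mu>))\<^sup>2) \<le> V k" for k
    unfolding V_def by (rule P_lower)
  have "x \<longlonglongrightarrow> y" "lam \<longlonglongrightarrow> \<mu>"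
    using sum_squares_le_null_sequence[OF le V0] by (simp_all add: LIM_zero_iff)
  with kkt' show thesis by (rule that)
qed

end

section \<open>The block structure\<close>

lemma step_matrix_nth: "(step_matrix \<alpha> *v u) $ p = \<alpha> (fst p) * u $ p"
  by (simp add: step_matrix_def matrix_vector_mult_def if_distrib[of "\<lambda>t. t * _"] cong: if_cong)

lemma prod_set_compact_convex_nonempty:
  fixes \<Omega> :: "'N::finite \<Rightarrow> (real ^ 'n::finite) set"
  assumes "\<And>i. \<Omega> i \<noteq> {} \<and> compact (\<Omega> i) \<and> convex (\<Omega> i)"
  shows "compact (prod_set \<Omega>)" "convex (prod_set \<Omega>)" "prod_set \<Omega> \<noteq> {}"
proof -
  have lin: "linear (\<lambda>x :: real ^ ('N \<times> 'n). blk x i)" for i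
    by (rule linearI) (auto simp: blk_def vec_eq_iff)
  have eq: "prod_set \<Omega> = (\<Inter>i. (\<lambda>x. blk x i) -` \<Omega> i)" by (auto simp: prod_set_def)
  have "closed ((\<lambda>x :: real ^ ('N \<times> 'n). blk x i) -` \<Omega> i)" for i
    using assms[of i] lin[of i]
    by (intro closed_vimage compact_imp_closed linear_continuous_on) (auto simp: linear_conv_bounded_linear)
  then have "closed (prod_set \<Omega>)" unfolding eq by (intro closed_INT) auto
  moreover have "bounded (prod_set \<Omega>)"
  proof -
    have "\<exists>B. \<forall>v\<in>\<Omega> i. norm v \<le> B" for i
      using assms[of i] compact_imp_bounded[of "\<Omega> i"] by (simp add: bounded_iff)
    then obtain B where B: "\<And>i v. v \<in> \<Omega> i \<Longrightarrow> norm v \<le> B i" by metis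
    have "norm x \<le> (\<Sum>p\<in>(UNIV :: ('N \<times> 'n) set). B (fst p))" if "x \<in> prod_set \<Omega>" for x
    proof -
      have "\<bar>x $ p\<bar> \<le> B (fst p)" for p
      proof -
        have "\<bar>x $ p\<bar> = \<bar>blk x (fst p) $ snd p\<bar>" by (simp add: blk_def)
        also have "\<dots> \<le> norm (blk x (fst p))" by (rule component_le_norm_cart)
        also have "\<dots> \<le> B (fst p)" using B that by (auto simp: prod_set_def)
        finally show ?thesis .
      qed
      then show ?thesis by (intro order_trans[OF norm_le_l1_cart] sum_mono)
    qed
    then show ?thesis unfolding bounded_iff by blast
  qed
  ultimately show "compact (prod_set \<Omega>)" by (simp add: compact_eq_bounded_closed)
  show "convex (prod_set \<Omega>)" unfolding eq
    using assms lin by (intro convex_INT convex_linear_vimage) auto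
  have "\<exists>v. v \<in> \<Omega> i" for i using assms[of i] by blast
  then obtain w where "\<And>i. w i \<in> \<Omega> i" by metis
  then have "col w \<in> prod_set \<Omega>" by (auto simp: prod_set_def blk_def col_def vec_lambda_eta)
  then show "prod_set \<Omega> \<noteq> {}" by blast
qed

text \<open>
  Since each block may be varied separately, the obtuse angle condition of the projection holds
  block by block and is stable under positive block weights.
\<close>

lemma closest_point_prod_set_weighted:
  fixes \<Omega> :: "'N::finite \<Rightarrow> (real ^ 'n::finite) set"
  assumes \<Omega>: "\<And>i. \<Omega> i \<noteq> {} \<and> compact (\<Omega> i) \<and> convex (\<Omega> i)"
    and c: "\<And>i. 0 \<le> c i" and z: "z \<in> prod_set \<Omega>"
  shows "(step_matrix c *v (y - closest_point (prod_set \<Omega>) y))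
      \<bullet> (z - closest_point (prod_set \<Omega>) y) \<le> 0"
proof -
  note S = prod_set_compact_convex_nonempty[of \<Omega>, OF \<Omega>]
  define w where "w = closest_point (prod_set \<Omega>) y"
  have w: "w \<in> prod_set \<Omega>"
    unfolding w_def using S by (intro closest_point_in_set compact_imp_closed)
  have block: "(\<Sum>k\<in>UNIV. (y - w) $ (i, k) * (z - w) $ (i, k)) \<le> 0" for i
  proof -
    \<comment> \<open>\<open>u\<close> is \<open>w\<close> with only block \<open>i\<close> taken
      from \<open>z\<close>, so the obtuse angle inequality at \<open>u\<close> reduces to that
      block.\<close>
    define u where "u = (\<chi> p. if fst p = i then z $ p else w $ p)"
    have "blk u j = (if j = i then blk z j else blk w j)" for j
      by (simp add: u_def blk_def)
    then have "u \<in> prod_set \<Omega>" using z w by (simp add: prod_set_def)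
    then have "(y - w) \<bullet> (u - w) \<le> 0"
      unfolding w_def using S by (intro closest_point_dot compact_imp_closed)
    moreover have "(y - w) \<bullet> (u - w)
        = (\<Sum>j\<in>UNIV. \<Sum>k\<in>UNIV. if j = i then (y - w) $ (j, k) * (z - w) $ (j, k) else 0)"
      unfolding inner_vec_def UNIV_Times_UNIV[symmetric] sum.cartesian_product
      by (intro sum.cong) (auto simp: u_def)
    moreover have "\<dots> = (\<Sum>j\<in>UNIV. if j = i then \<Sum>k\<in>UNIV. (y - w) $ (j, k) * (z - w) $ (j, k) else 0)"
      by (intro sum.cong) auto
    ultimately show ?thesis by simp
  qed
  have "(step_matrix c *v (y - w)) \<bullet> (z - w)
      = (\<Sum>i\<in>UNIV. c i * (\<Sum>k\<in>UNIV. (y - w) $ (i, k) * (z - w) $ (i, k)))"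
    unfolding inner_vec_def UNIV_Times_UNIV[symmetric] sum_distrib_left sum.cartesian_product
    by (intro sum.cong) (auto simp: step_matrix_nth)
  also have "\<dots> \<le> 0" by (rule sum_nonpos) (rule mult_nonneg_nonpos[OF c block])
  finally show ?thesis by (simp add: w_def)
qed

lemma step_matrix_inverse:
  assumes "\<And>i. \<alpha> i \<noteq> 0"
  shows "step_matrix (\<lambda>i. 1 / \<alpha> i) *v (step_matrix \<alpha> *v u) = u"
  using assms by (simp add: vec_eq_iff step_matrix_nth)

lemma step_matrix_symmetric: "(step_matrix c *v u) \<bullet> v = u \<bullet> (step_matrix c *v v)"
  by (simp add: inner_vec_def step_matrix_nth mult.left_commute mult.assoc)

lemma step_matrix_lower:
  assumes "\<And>i. d \<le> c i"
  shows "d * (norm u)\<^sup>2 \<le> (step_matrix c *v u) \<bullet> u"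
proof -
  have "d * (norm u)\<^sup>2 = (\<Sum>p\<in>UNIV. d * (u $ p * u $ p))"
    by (simp add: power2_norm_eq_inner inner_vec_def sum_distrib_left)
  also have "\<dots> \<le> (\<Sum>p\<in>UNIV. c (fst p) * (u $ p * u $ p))"
    using assms by (intro sum_mono mult_right_mono) auto
  also have "\<dots> = (step_matrix c *v u) \<bullet> u"
    by (simp add: inner_vec_def step_matrix_nth mult.assoc)
  finally show ?thesis .
qed

section \<open>The dual orthant, normal cones and coercivity of the preconditioner\<close>

lemma nonneg_orthant_closed_convex:
  "closed (nonneg_orthant :: (real ^ 'm::finite) set)" "convex (nonneg_orthant :: (real ^ 'm) set)"
  "(nonneg_orthant :: (real ^ 'm) set) \<noteq> {}"
proof -
  have eq: "nonneg_orthant = (\<Inter>j. {\<mu> :: real ^ 'm. 0 \<le> \<mu> $ j})"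
    by (auto simp: nonneg_orthant_def)
  show "closed (nonneg_orthant :: (real ^ 'm) set)"
    unfolding eq by (intro closed_INT ballI closed_Collect_le continuous_intros)
  show "convex (nonneg_orthant :: (real ^ 'm) set)"
    by (rule convexI) (auto simp: nonneg_orthant_def)
  show "(nonneg_orthant :: (real ^ 'm) set) \<noteq> {}" by (auto simp: nonneg_orthant_def intro: exI[of _ 0])
qed

lemma mem_normal_cone_iff:
  "v \<in> normal_cone S x \<longleftrightarrow> x \<in> S \<and> (\<forall>z\<in>S. v \<bullet> (z - x) \<le> 0)"
  by (simp add: normal_cone_def SUP_le_iff)

text \<open>The normal vectors \<open>- (F x + transpose A *v \<mu>)\<close> and
  \<open>A *v x - b\<close> cancel the remaining terms of the two components.\<close>

lemma kkt_point_imp_zer: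
  fixes A :: "real ^ 'd::finite ^ 'm::finite"
  assumes "kkt_point S nonneg_orthant F ((*v) A) b x \<mu>"
  shows "(x, \<mu>) \<in> zer (kkt_op S F A b)"
proof -
  note kkt = assms[unfolded kkt_point_def adjoint_matrix]
  have "- (F x + transpose A *v \<mu>) \<in> normal_cone S x"
    using kkt unfolding mem_normal_cone_iff inner_minus_left by simp
  moreover have "A *v x - b \<in> normal_cone nonneg_orthant \<mu>"
    using kkt by (simp add: mem_normal_cone_iff)
  ultimately show ?thesis
    unfolding zer_def kkt_op_def zero_prod_def
    by (force simp: algebra_simps)
qed

text \<open>
  Young's inequality splits the cross term with a weight strictly between \<open>\<gamma> c\<^sup>2\<close> and \<open>\<kappa>\<close>, which leaves
  a positive multiple of both squares.
\<close>

lemma preconditioner_coercive: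
  fixes A :: "'a::real_inner \<Rightarrow> 'b::real_inner"
  assumes A: "\<And>u. norm (A u) \<le> c * norm u" and c: "0 \<le> c" and \<gamma>: "0 < \<gamma>" and \<kappa>: "\<gamma> * c\<^sup>2 < \<kappa>"
  obtains \<delta> where "0 < \<delta>"
    "\<And>u w. \<delta> * ((norm u)\<^sup>2 + (norm w)\<^sup>2) \<le> \<kappa> * (norm u)\<^sup>2 - 2 * (A u \<bullet> w) + (norm w)\<^sup>2 / \<gamma>"
proof -
  define s where "s = (\<kappa> + \<gamma> * c\<^sup>2) / 2"
  have "0 \<le> \<gamma> * c\<^sup>2" using \<gamma> by simp
  then have s: "\<gamma> * c\<^sup>2 < s" "s < \<kappa>" "0 < s" using \<kappa> by (auto simp: s_def)
  \<comment> \<open>These are the coefficients that remain on the two squares after Young's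
    inequality; the second is positive because \<open>\<gamma> * c\<^sup>2 < s\<close>.\<close>
  define \<delta> where "\<delta> = min (\<kappa> - s) (1 / \<gamma> - c\<^sup>2 / s)"
  show thesis
  proof (rule that[of \<delta>])
    show "0 < \<delta>" using s \<gamma> by (simp add: \<delta>_def field_simps)
    fix u w
    have "A u \<bullet> w \<le> norm (A u) * norm w" by (rule norm_cauchy_schwarz)
    also have "\<dots> \<le> c * norm u * norm w" using A by (simp add: mult_right_mono)
    finally have "2 * (A u \<bullet> w) \<le> 2 * (c * norm u * norm w)" by simp
    also have "\<dots> \<le> s * (norm u)\<^sup>2 + c\<^sup>2 / s * (norm w)\<^sup>2"
    proof -
      have "0 \<le> (s * norm u - c * norm w)\<^sup>2 / s" using s by simp
      also have "\<dots> = s * (norm u)\<^sup>2 + c\<^sup>2 / s * (norm w)\<^sup>2 - 2 * (c * norm u * norm w)"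
        using s by (simp add: field_simps power2_eq_square)
      finally show ?thesis by simp
    qed
    finally have cross: "2 * (A u \<bullet> w) \<le> s * (norm u)\<^sup>2 + c\<^sup>2 / s * (norm w)\<^sup>2" .
    have "\<delta> * (norm u)\<^sup>2 \<le> (\<kappa> - s) * (norm u)\<^sup>2"
      "\<delta> * (norm w)\<^sup>2 \<le> (1 / \<gamma> - c\<^sup>2 / s) * (norm w)\<^sup>2"
      by (intro mult_right_mono; simp add: \<delta>_def)+
    then show "\<delta> * ((norm u)\<^sup>2 + (norm w)\<^sup>2) \<le> \<kappa> * (norm u)\<^sup>2 - 2 * (A u \<bullet> w) + (norm w)\<^sup>2 / \<gamma>"
      using cross by (simp add: algebra_simps)
  qed
qed

section \<open>Convergence of the projected primal-dual iteration\<close>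

theorem theorem1:
  fixes f :: "'N::finite \<Rightarrow> real ^ 'n::finite \<Rightarrow> real ^ 'n \<Rightarrow> real"
    and \<Omega> :: "'N \<Rightarrow> (real ^ 'n) set"
    and A :: "real ^ ('N \<times> 'n) ^ 'm::finite"
    and b :: "real ^ 'm"
    and \<alpha> :: "'N \<Rightarrow> real"
    and \<eta> l\<^sub>F \<gamma> :: real
    and x :: "nat \<Rightarrow> real ^ ('N \<times> 'n)"
    and lam :: "nat \<Rightarrow> real ^ 'm"
  assumes cost_convex: "\<And>i y. convex_on UNIV (\<lambda>u. agg_cost f i u y)"
    and cost_C1: "\<And>i y. continuously_differentiable (\<lambda>u. agg_cost f i u y)"
    and local_sets: "\<And>i. \<Omega> i \<noteq> {} \<and> compact (\<Omega> i) \<and> convex (\<Omega> i)"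
    and slater: "\<exists>z \<in> prod_set \<Omega>. \<forall>j. (A *v z) $ j < b $ j"
    and eta_pos: "\<eta> > 0"
    and lF_pos: "l\<^sub>F > 0"
    and strong_mono: "strongly_monotone \<eta> (pseudo_gradient f)"
    and lipschitz: "l\<^sub>F-lipschitz_on UNIV (pseudo_gradient f)"
    and alpha: "\<And>i. 0 < \<alpha> i \<and> \<alpha> i < 2 * \<eta> / l\<^sub>F\<^sup>2"
    and gamma: "0 < \<gamma>" "ereal \<gamma> < gamma_max A \<alpha> \<eta> l\<^sub>F"
    and x_step: "\<And>k. x (Suc k) = closest_point (prod_set \<Omega>)
        (x k - step_matrix \<alpha> *v (pseudo_gradient f (x k) + transpose A *v lam k))"
    and lambda_step: "\<And>k. lam (Suc k) = closest_point nonneg_orthant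
        (lam k + \<gamma> *\<^sub>R (2 *\<^sub>R (A *v x (Suc k)) - A *v x k - b))"
  shows "\<exists>\<omega> \<in> zer (kkt_op (prod_set \<Omega>) (pseudo_gradient f) A b).
           (\<lambda>k. (x k, lam k)) \<longlonglongrightarrow> \<omega>"
proof -
  define S where "S = prod_set \<Omega>"
  define F where "F = pseudo_gradient f"
  define D where "D = (\<lambda>u :: real ^ ('N \<times> 'n). step_matrix (\<lambda>i. 1 / \<alpha> i) *v u)"
  define \<beta> where "\<beta> = \<eta> / l\<^sub>F\<^sup>2"
  define \<alpha>max where "\<alpha>max = Max (range \<alpha>)"
  \<comment> \<open>As \<open>2 * \<beta>\<close> is the upper limit for the step sizes, \<kappa> is
    the bracket in the definition of \<open>gamma_max\<close>.\<close>
  define \<kappa> where "\<kappa> = 1 / \<alpha>max - 1 / (2 * \<beta>)"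
  note S = prod_set_compact_convex_nonempty[of \<Omega>, OF local_sets, folded S_def]
  note \<Lambda> = nonneg_orthant_closed_convex[where 'm = 'm]
  have \<beta>_pos: "0 < \<beta>" using eta_pos lF_pos by (simp add: \<beta>_def)
  have "\<alpha>max \<in> range \<alpha>" unfolding \<alpha>max_def by (intro Max_in) auto
  then have \<alpha>max: "0 < \<alpha>max" "\<alpha>max < 2 * \<beta>" using alpha by (auto simp: \<beta>_def)
  then have \<kappa>_pos: "0 < \<kappa>" by (simp add: \<kappa>_def field_simps)
  \<comment> \<open>For \<open>A = 0\<close> the bound on \<gamma> is infinite and
    \<open>c = 0\<close> works. Otherwise \<open>c\<close> is the maximum singular value, whose
    square is shown to be positive before the bound is multiplied by it.\<close>
  obtain c where c: "0 \<le> c" "\<And>u. norm (A *v u) \<le> c * norm u" "\<gamma> * c\<^sup>2 < \<kappa>"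
  proof (cases "A = 0")
    case True
    then show thesis using that[of 0] \<kappa>_pos by simp
  next
    case False
    let ?c = "max_singular_value A"
    have "?c \<noteq> 0"
    proof
      assume "?c = 0"
      then have "A *v u = 0" for u using norm_le_max_singular_value[of A u] by simp
      then have "A = 0" by (metis matrix_eq matrix_vector_mult_0)
      with False show False by simp
    qed
    then have "0 < ?c\<^sup>2" by simp
    moreover have "\<gamma> < \<kappa> / ?c\<^sup>2"
      using gamma(2) False by (simp add: gamma_max_def \<kappa>_def \<alpha>max_def \<beta>_def)
    ultimately have "\<gamma> * ?c\<^sup>2 < \<kappa>" by (simp add: pos_less_divide_eq)
    then show thesis using that norm_le_max_singular_value max_singular_value_nonneg by blast
  qed
  obtain \<delta> where \<delta>: "0 < \<delta>" "\<And>u w. \<delta> * ((norm u)\<^sup>2 + (norm w)\<^sup>2)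
      \<le> \<kappa> * (norm u)\<^sup>2 - 2 * ((A *v u) \<bullet> w) + (norm w)\<^sup>2 / \<gamma>"
    using preconditioner_coercive[where A = "(*v) A", OF c(2,1) gamma(1) c(3)] by blast
  have D_lower: "1 / \<alpha>max * (norm u)\<^sup>2 \<le> D u \<bullet> u" for u
    unfolding D_def
  proof (rule step_matrix_lower)
    fix i
    have "\<alpha> i \<le> \<alpha>max" by (simp add: \<alpha>max_def)
    then show "1 / \<alpha>max \<le> 1 / \<alpha> i" using alpha by (simp add: frac_le)
  qed
  have F_cont: "continuous_on UNIV F"
    unfolding F_def using lipschitz by (rule lipschitz_on_continuous_on)
  interpret preconditioned_forward_backward S nonneg_orthant F "(*v) A" b D \<gamma> \<beta> \<delta> x lam
  proof (rule preconditioned_forward_backward.intro)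
    show "linear ((*v) A)" "linear D" by (simp_all add: D_def)
    show "D u \<bullet> v = u \<bullet> D v" for u v by (simp add: D_def step_matrix_symmetric)
    show "\<beta> * (norm (F u - F v))\<^sup>2 \<le> (F u - F v) \<bullet> (u - v)" for u v
      unfolding \<beta>_def F_def
      by (rule strongly_monotone_lipschitz_cocoercive[OF strong_mono lipschitz lF_pos])
        (use eta_pos in simp)
    \<comment> \<open>Since \<kappa> + 1/(2 \<beta>) equals \<open>1 / \<alpha>max\<close>, the
      lower bound on \<open>D\<close> pays for both \<kappa> and the forward step.\<close>
    show "\<delta> * ((norm u)\<^sup>2 + (norm w)\<^sup>2) + (norm u)\<^sup>2 / (2 * \<beta>)
        \<le> D u \<bullet> u - 2 * ((A *v u) \<bullet> w) + (norm w)\<^sup>2 / \<gamma>" for u w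
      using \<delta>(2)[of u w] D_lower[of u] by (simp add: \<kappa>_def left_diff_distrib)
    show "x (Suc k) \<in> S" for k
      unfolding x_step S_def[symmetric] using S by (intro closest_point_in_set compact_imp_closed)
    show "lam (Suc k) \<in> nonneg_orthant" for k
      unfolding lambda_step using \<Lambda> by (intro closest_point_in_set)
    show "(D (x k - x (Suc k)) - F (x k) - adjoint ((*v) A) (lam k)) \<bullet> (z - x (Suc k)) \<le> 0"
      if "z \<in> S" for k z
    proof -
      define g where "g = F (x k) + transpose A *v lam k"
      \<comment> \<open>The projection is Euclidean, but the product structure permits weighting its
        inequality by \<open>D\<close>, which turns the scaled step
        \<open>step_matrix \<alpha> *v g\<close> back into \<open>g\<close>.\<close>
      have "D (x k - step_matrix \<alpha> *v g - x (Suc k)) \<bullet> (z - x (Suc k)) \<le> 0"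
        unfolding x_step F_def[symmetric] g_def[symmetric] unfolding D_def
        by (rule closest_point_prod_set_weighted[where \<Omega> = \<Omega>, OF local_sets])
          (use alpha that in \<open>auto simp: S_def less_imp_le\<close>)
      moreover have "D (step_matrix \<alpha> *v g) = g"
        unfolding D_def using alpha by (intro step_matrix_inverse) (metis less_irrefl)
      moreover have "D (x k - step_matrix \<alpha> *v g - x (Suc k))
          = D (x k - x (Suc k)) - D (step_matrix \<alpha> *v g)"
        by (simp add: D_def matrix_vector_mult_diff_distrib)
      ultimately have "(D (x k - x (Suc k)) - g) \<bullet> (z - x (Suc k)) \<le> 0" by simp
      then show ?thesis by (simp only: g_def adjoint_matrix diff_diff_eq)
    qed
    show "((1 / \<gamma>) *\<^sub>R (lam k - lam (Suc k)) + 2 *\<^sub>R (A *v x (Suc k)) - A *v x k - b)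
        \<bullet> (\<nu> - lam (Suc k)) \<le> 0" if "\<nu> \<in> nonneg_orthant" for k \<nu>
    proof -
      define r where "r = 2 *\<^sub>R (A *v x (Suc k)) - A *v x k - b"
      have "(lam k + \<gamma> *\<^sub>R r - lam (Suc k)) \<bullet> (\<nu> - lam (Suc k)) \<le> 0"
        unfolding lambda_step r_def[symmetric] using \<Lambda> that by (intro closest_point_dot)
      then have "(1 / \<gamma>) * ((lam k + \<gamma> *\<^sub>R r - lam (Suc k)) \<bullet> (\<nu> - lam (Suc k))) \<le> 0"
        using gamma(1) by (intro mult_nonneg_nonpos) auto
      also have "(1 / \<gamma>) * ((lam k + \<gamma> *\<^sub>R r - lam (Suc k)) \<bullet> (\<nu> - lam (Suc k)))
          = ((1 / \<gamma>) *\<^sub>R (lam k - lam (Suc k)) + r) \<bullet> (\<nu> - lam (Suc k))"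
        using gamma(1) by (simp add: inner_add_left inner_diff_left field_simps)
      finally show ?thesis by (simp add: r_def algebra_simps)
    qed
  qed (use \<beta>_pos \<delta> gamma F_cont S \<Lambda> in \<open>auto intro: compact_imp_closed\<close>)
  obtain z0 where z0: "z0 \<in> S" "\<And>j. (A *v z0) $ j < b $ j" using slater by (auto simp: S_def)
  obtain y0 \<mu>0 where "kkt_point S nonneg_orthant F ((*v) A) b y0 \<mu>0"
    using kkt_point_exists[OF matrix_vector_mul_linear S(1,2) continuous_on_subset[OF F_cont subset_UNIV] z0]
    by blast
  then obtain y \<mu> where kkt: "kkt_point S nonneg_orthant F ((*v) A) b y \<mu>"
    and lim: "x \<longlonglongrightarrow> y" "lam \<longlonglongrightarrow> \<mu>"
    by (rule converges_to_kkt_point)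
  show ?thesis
    using kkt_point_imp_zer[OF kkt] tendsto_Pair[OF lim] unfolding S_def F_def by blast
qed

end
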